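(* Consider the semi-discrete Lagrangian HTC scheme described in the context with vanishing source, i.e. $\tau_2\to\infty$, and with initially curl-free data for the thermal impulse given by the discrete gradient of a scalar potential $Z$ defined at the nodes, $$\mathbf J_c(0)=\nabla_c^pZ_p(0),$$ which thus satisfies $\nabla_p^c\times\mathbf J_c(0)=0$. Assuming exact time integration, the semi-discrete scheme preserves the curl-free condition of $\mathbf J_c$ exactly at the semi-discrete level for all times, i.e. $$\nabla_p^c\times\mathbf J_c=0.$$
   Context: **Mesh.** In two space dimensions, the moving domain $\Omega(t)$ is discretized by non-overlapping triangles $\omega_c(t)$ of area $|\omega_c|$, with fixed topology and moving nodes $p$ at positions $\mathbf x_p$. $\mathcal P(c)$ is the set of vertices of $\omega_c$, and $\mathcal C(p)$ is the set of cells sharing node $p$. For $p\in\mathcal P(c)$ the corner normal is $l_{pc}\mathbf n_{pc}=l_{pc}^+\mathbf n_{pc}^++l_{pc}^-\mathbf n_{pc}^-$, where $l_{pc}^\pm$ are the half lengths of the two edges of $\omega_c$ meeting at $p$ and $\mathbf n_{pc}^\pm$ their outward unit normals; $\mathbf n_{pc}=(n_{pc}^k)_k$ is a unit vector and $l_{pc}$ the length of the corner normal. The sub-cell $\omega_{pc}$ is the quadrilateral obtained by connecting $\mathbf x_p$, the barycenter of $\omega_c$ and the midpoints of the two edges of $\omega_c$ at $p$. The dual cell is $\omega_p=\bigcup_{c\in\mathcal C(p)}\omega_{pc}$, of area $|\omega_p|$. Nodes move by $\frac{d\mathbf x_p}{dt}=\mathbf v_p$. **Discrete operators.** For a scalar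 field $\phi_p$ defined in the nodes, the discrete gradient in cell $c$ is $\nabla_c^p\phi_p=\frac1{|\omega_c|}\sum_{p\in\mathcal P(c)}l_{pc}\mathbf n_{pc}\phi_p$. For a vector field $\mathbf J_c$ defined in the cells, the dual discrete curl at node $p$ is $\nabla_p^c\times\mathbf J_c=-\frac1{|\omega_p|}\sum_{c\in\mathcal C(p)}l_{pc}\mathbf n_{pc}\times\mathbf J_c$, and the volume-integrated discrete divergence of $\rho\boldsymbol\beta$ at node $p$ is $|\omega_p|\nabla_p^c\cdot(\rho_c\boldsymbol\beta_c)=-\sum_{c\in\mathcal C(p)}l_{pc}\mathbf n_{pc}\cdot\rho_c\boldsymbol\beta_c$. In cross products, planar vectors are padded with a zero third component. **State and energy.** Each cell carries specific volume $\tau_c=1/\rho_c$ (with $\rho$ the density), velocity $\mathbf v_c$, specific entropy $S_c$, distortion field $\mathbf A_c$ and specific thermal impulse $\mathbf J_c$. The cell mass $m_c=\rho_c|\omega_c|$ is constant in time. The specific total energy is $E=E_1(\tau,S)+\frac12|\mathbf v|^2+\frac14c_s^2\,\mathring G_{ij}\mathring G_{ij}+\frac12c_h^2|\mathbf J|^2$, where $E_1$ is a given convex function (the equation of state), $\mathbf G=\mathbf A^T\mathbf A$, $\mathring G_{ij}=G_{ij}-\frac13G_{mm}\delta_{ij}$, and $c_s,c_h$ are constants. The dual variables are $p=-\partial E/\partial\tau$ (pressure), $T=\partial E/\partial S$ (temperature, assumed positive), $\boldsymbol\Gamma=\partial E/\partial\mathbf A$, $\boldsymbol\beta=\partial E/\partial\mathbf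 J$. The stress tensor is $\boldsymbol\sigma=\rho\mathbf A^T\boldsymbol\Gamma+\rho\,\mathbf J\otimes\boldsymbol\beta$. A subscript $c$ means evaluation at the state of cell $c$. $\theta_1=\theta_1(\tau_1)>0$ and $\theta_2=\theta_2(\tau_2)>0$ are given functions depending on relaxation times $\tau_1,\tau_2>0$; vanishing source $\tau_2\to\infty$ means that the terms with $1/\theta_2$ are absent. **Scheme** (summation over repeated component indices $i,k,l$): $$m_c\frac{d\tau_c}{dt}-\sum_{p\in\mathcal P(c)}l_{pc}\mathbf n_{pc}\cdot(\mathbf v_p-\mathbf v_c)=0,$$ $$m_c\frac{d v_c^i}{dt}+\sum_{p\in\mathcal P(c)}\Big(l_{pc}n_{pc}^i(p_p-p_c)+l_{pc}n_{pc}^k(\sigma_p^{ik}-\sigma_c^{ik})\Big)+\sum_{p\in\mathcal P(c)}l_{pc}(\alpha_p+\epsilon_p)(v_c^i-v_p^i)=0,$$ $$m_c\frac{dS_c}{dt}+\sum_{p\in\mathcal P(c)}l_{pc}\mathbf n_{pc}\cdot(\rho_p\boldsymbol\beta_p-\rho_c\boldsymbol\beta_c)=\Pi_c+\pi_c\ge0,$$ $$m_c\frac{dA_c^{ik}}{dt}+\rho_cA_c^{il}\sum_{p\in\mathcal P(c)}l_{pc}n_{pc}^k(v_p^l-v_c^l)=-\frac1{\theta_1}\Gamma_c^{ik},$$ $$m_c\frac{dJ_c^i}{dt}+\rho_cJ_c^l\sum_{p\in\mathcal P(c)}l_{pc}n_{pc}^i(v_p^l-v_c^l)+\rho_c\sum_{p\in\mathcal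 P(c)}l_{pc}n_{pc}^i(T_p-T_c)+\rho_c\sum_{p\in\mathcal P(c)}l_{pc}n_{pc}^i(\alpha_p+\epsilon_p)\,|\omega_p|\nabla_p^c\cdot(\rho_c\boldsymbol\beta_c)=-\frac1{\theta_2}\beta_c^i,$$ where $\epsilon_p\ge0$ is a numerical viscosity and each nodal value is the average $q_p=\big(\sum_{c\in\mathcal C(p)}l_{pc}q_c\big)/\sum_{c\in\mathcal C(p)}l_{pc}$ for $q\in\{\mathbf v,p,\rho,T,\boldsymbol\sigma,\boldsymbol\beta\}$. The entropy production terms are $\pi_c=\frac{\boldsymbol\Gamma_c:\boldsymbol\Gamma_c}{T_c\theta_1}+\frac{\boldsymbol\beta_c\cdot\boldsymbol\beta_c}{T_c\theta_2}$ and $\Pi_c=\sum_{p\in\mathcal P(c)}\frac{|\omega_{pc}|}{|\omega_c|}\frac{\Pi_p}{T_c}$ with $\Pi_p=\epsilon_p\delta_p$ and $$\delta_p=\sum_{c\in\mathcal C(p)}l_{pc}|\mathbf v_c-\mathbf v_p|^2+\big(|\omega_p|\nabla_p^c\cdot(\rho_c\boldsymbol\beta_c)\big)^2\ge0.$$ The scalar correction factor is $\alpha_p=\nu_p/\delta_p$, with $\alpha_p=0$ if $\delta_p=0$, where $$\nu_p=\sum_{c\in\mathcal C(p)}l_{pc}n_{pc}^k\Big(p_cv_c^k-p_cv_p^k-p_pv_c^k+\sigma_c^{ik}v_c^i-\sigma_c^{ik}v_p^i-\sigma_p^{ik}v_c^i+T_c\rho_c\beta_c^k-T_c\rho_p\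beta_p^k-T_p\rho_c\beta_c^k\Big).$$
   Formalization: The curl-free condition is proved at interior nodes only (nodes not on a boundary edge, so all nodes of a periodic mesh); at boundary nodes it already fails initially, e.g. for a single triangle with Z equal to 1 at one vertex and 0 at the others. *)

theory Defs
  imports "HOL-Analysis.Analysis"
begin

section \<open>Triangular meshes\<close>

text \<open>
  The connectivity is fixed in time; only the node positions \<open>x\<close>, which are passed separately,
  move. Everything in this and the next two sections refers to one instant of time.
\<close>

record ('c, 'n) mesh =
  cells :: "'c set"
  verts :: "'c \<Rightarrow> 'n set"

definition nodes :: "('c, 'n) mesh \<Rightarrow> 'n set" where
  "nodes M = (\<Union>c\<in>cells M. verts M c)"

definition cells_at :: "('c, 'n) mesh \<Rightarrow> 'n \<Rightarrow> 'c set" where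
  "cells_at M p = {c \<in> cells M. p \<in> verts M c}"

definition tri :: "('c, 'n) mesh \<Rightarrow> ('n \<Rightarrow> real^2) \<Rightarrow> 'c \<Rightarrow> (real^2) set" where
  "tri M x c = convex hull (x ` verts M c)"

text \<open>
  The mesh only has to be locally finite. This covers finite meshes as well as the periodic
  unfolding of a mesh without boundary, in which every node is interior.
\<close>

definition triangular_mesh :: "('c, 'n) mesh \<Rightarrow> ('n \<Rightarrow> real^2) \<Rightarrow> bool" where
  "triangular_mesh M x \<longleftrightarrow>
     (\<forall>c\<in>cells M. card (verts M c) = 3 \<and> \<not> collinear (x ` verts M c)) \<and>
     (\<forall>p\<in>nodes M. finite (cells_at M p)) \<and>
     (\<forall>c\<in>cells M. \<forall>c'\<in>cells M. c \<noteq> c' \<longrightarrow> interior (tri M x c) \<inter> interior (tri M x c') = {})"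

text \<open>
  A node is interior if it is not an end point of a boundary edge, that is, if every edge
  emanating from it separates two cells.
\<close>

definition interior_node :: "('c, 'n) mesh \<Rightarrow> 'n \<Rightarrow> bool" where
  "interior_node M p \<longleftrightarrow> p \<in> nodes M \<and>
     (\<forall>c\<in>cells_at M p. \<forall>q\<in>verts M c - {p}. \<exists>c'\<in>cells_at M p. c' \<noteq> c \<and> q \<in> verts M c')"

definition area :: "('c, 'n) mesh \<Rightarrow> ('n \<Rightarrow> real^2) \<Rightarrow> 'c \<Rightarrow> real" where
  "area M x c = measure lebesgue (tri M x c)"

definition barycenter :: "('c, 'n) mesh \<Rightarrow> ('n \<Rightarrow> real^2) \<Rightarrow> 'c \<Rightarrow> real^2" where
  "barycenter M x c = (1/3) *\<^sub>R (\<Sum>p\<in>verts M c. x p)"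

definition subcell :: "('c, 'n) mesh \<Rightarrow> ('n \<Rightarrow> real^2) \<Rightarrow> 'c \<Rightarrow> 'n \<Rightarrow> (real^2) set" where
  "subcell M x c p =
     convex hull ({x p, barycenter M x c} \<union> (\<lambda>q. midpoint (x p) (x q)) ` (verts M c - {p}))"

definition subcell_area :: "('c, 'n) mesh \<Rightarrow> ('n \<Rightarrow> real^2) \<Rightarrow> 'c \<Rightarrow> 'n \<Rightarrow> real" where
  "subcell_area M x c p = measure lebesgue (subcell M x c p)"

definition dual_area :: "('c, 'n) mesh \<Rightarrow> ('n \<Rightarrow> real^2) \<Rightarrow> 'n \<Rightarrow> real" where
  "dual_area M x p = measure lebesgue (\<Union>c\<in>cells_at M p. subcell M x c p)"

definition edge_normal ::
  "('c, 'n) mesh \<Rightarrow> ('n \<Rightarrow> real^2) \<Rightarrow> 'c \<Rightarrow> 'n \<Rightarrow> 'n \<Rightarrow> real^2" where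
  "edge_normal M x c p q =
     (THE n. norm n = 1 \<and> n \<bullet> (x q - x p) = 0 \<and> (\<forall>y\<in>tri M x c. n \<bullet> (y - x p) \<le> 0))"

definition pad :: "real^2 \<Rightarrow> real^3" where
  "pad v = vector [v$1, v$2, 0]"

definition planar :: "real^3 \<Rightarrow> real^2" where
  "planar v = vector [v$1, v$2]"

text \<open>
  \<open>cnormal M x c p\<close> is the whole vector \<open>l\<^sub>p\<^sub>c n\<^sub>p\<^sub>c\<close>, not the unit
  vector \<open>n\<^sub>p\<^sub>c\<close>, and it is padded with a zero third component.
\<close>

definition cnormal :: "('c, 'n) mesh \<Rightarrow> ('n \<Rightarrow> real^2) \<Rightarrow> 'c \<Rightarrow> 'n \<Rightarrow> real^3" where
  "cnormal M x c p =
     pad (\<Sum>q\<in>verts M c - {p}. (dist (x p) (x q) / 2) *\<^sub>R edge_normal M x c p q)"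

definition clen :: "('c, 'n) mesh \<Rightarrow> ('n \<Rightarrow> real^2) \<Rightarrow> 'c \<Rightarrow> 'n \<Rightarrow> real" where
  "clen M x c p = norm (cnormal M x c p)"


section \<open>Discrete operators\<close>

definition disc_grad ::
  "('c, 'n) mesh \<Rightarrow> ('n \<Rightarrow> real^2) \<Rightarrow> ('n \<Rightarrow> real) \<Rightarrow> 'c \<Rightarrow> real^3" where
  "disc_grad M x \<phi> c = (1 / area M x c) *\<^sub>R (\<Sum>p\<in>verts M c. \<phi> p *\<^sub>R cnormal M x c p)"

definition dual_curl ::
  "('c, 'n) mesh \<Rightarrow> ('n \<Rightarrow> real^2) \<Rightarrow> ('c \<Rightarrow> real^3) \<Rightarrow> 'n \<Rightarrow> real^3" where
  "dual_curl M x J p =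
     - ((1 / dual_area M x p) *\<^sub>R (\<Sum>c\<in>cells_at M p. cross3 (cnormal M x c p) (J c)))"

text \<open>The volume-integrated dual divergence, that is, the divergence times the dual area.\<close>

definition int_dual_div ::
  "('c, 'n) mesh \<Rightarrow> ('n \<Rightarrow> real^2) \<Rightarrow> ('c \<Rightarrow> real^3) \<Rightarrow> 'n \<Rightarrow> real" where
  "int_dual_div M x F p = - (\<Sum>c\<in>cells_at M p. cnormal M x c p \<bullet> F c)"

definition nodal_avg ::
  "('c, 'n) mesh \<Rightarrow> ('n \<Rightarrow> real^2) \<Rightarrow> ('c \<Rightarrow> 'a::real_vector) \<Rightarrow> 'n \<Rightarrow> 'a" where
  "nodal_avg M x q p =
     (1 / (\<Sum>c\<in>cells_at M p. clen M x c p)) *\<^sub>R (\<Sum>c\<in>cells_at M p. clen M x c p *\<^sub>R q c)"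


section \<open>State, energy and dual variables\<close>

text \<open>
  As usual for this system in two space dimensions, vector and tensor fields keep all three
  components, while nothing depends on the third coordinate. The corner normals have no third
  component, and the nodes move with the planar part of the nodal velocity.
\<close>

record cell_state =
  spec_vol :: real
  vel :: "real^3"
  entropy :: real
  distortion :: "real^3^3"
  impulse :: "real^3"

definition rho :: "cell_state \<Rightarrow> real" where
  "rho u = 1 / spec_vol u"

definition metric_dev :: "real^3^3 \<Rightarrow> real^3^3" where
  "metric_dev A = (let G = transpose A ** A in G - mat (trace G / 3))"

definition energy ::
  "(real \<Rightarrow> real \<Rightarrow> real) \<Rightarrow> real \<Rightarrow> real \<Rightarrow> cell_state \<Rightarrow> real" where
  "energy E1 cs ch u =
     E1 (spec_vol u) (entropy u) + 1/2 * (norm (vel u))\<^sup>2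
     + 1/4 * cs\<^sup>2 * (\<Sum>i\<in>UNIV. \<Sum>j\<in>UNIV. metric_dev (distortion u) $ i $ j * metric_dev (distortion u) $ i $ j)
     + 1/2 * ch\<^sup>2 * (norm (impulse u))\<^sup>2"

definition pres :: "(cell_state \<Rightarrow> real) \<Rightarrow> cell_state \<Rightarrow> real" where
  "pres E u = - deriv (\<lambda>s. E (u\<lparr>spec_vol := s\<rparr>)) (spec_vol u)"

definition temp :: "(cell_state \<Rightarrow> real) \<Rightarrow> cell_state \<Rightarrow> real" where
  "temp E u = deriv (\<lambda>s. E (u\<lparr>entropy := s\<rparr>)) (entropy u)"

text \<open>
  The partial derivatives with respect to the components: \<open>axis i (axis k s)\<close> is the
  matrix whose only nonzero entry is \<open>s\<close>, at position \<open>(i, k)\<close>.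
\<close>

definition Gam :: "(cell_state \<Rightarrow> real) \<Rightarrow> cell_state \<Rightarrow> real^3^3" where
  "Gam E u = (\<chi> i k. deriv (\<lambda>s. E (u\<lparr>distortion := distortion u + axis i (axis k s)\<rparr>)) 0)"

definition bet :: "(cell_state \<Rightarrow> real) \<Rightarrow> cell_state \<Rightarrow> real^3" where
  "bet E u = (\<chi> i. deriv (\<lambda>s. E (u\<lparr>impulse := impulse u + axis i s\<rparr>)) 0)"

definition stress :: "(cell_state \<Rightarrow> real) \<Rightarrow> cell_state \<Rightarrow> real^3^3" where
  "stress E u = rho u *\<^sub>R (transpose (distortion u) ** Gam E u)
     + rho u *\<^sub>R (\<chi> i k. impulse u $ i * bet E u $ k)"


section \<open>Correction factor and entropy production\<close>

text \<open>
  In the rest of the theory \<open>u c\<close> is the state of cell \<open>c\<close> and \<open>E\<close> is the specific total energy.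
\<close>

abbreviation vel_p where "vel_p M x u p \<equiv> nodal_avg M x (\<lambda>c. vel (u c)) p"
abbreviation pres_p where "pres_p E M x u p \<equiv> nodal_avg M x (\<lambda>c. pres E (u c)) p"
abbreviation rho_p where "rho_p M x u p \<equiv> nodal_avg M x (\<lambda>c. rho (u c)) p"
abbreviation temp_p where "temp_p E M x u p \<equiv> nodal_avg M x (\<lambda>c. temp E (u c)) p"
abbreviation stress_p where "stress_p E M x u p \<equiv> nodal_avg M x (\<lambda>c. stress E (u c)) p"
abbreviation bet_p where "bet_p E M x u p \<equiv> nodal_avg M x (\<lambda>c. bet E (u c)) p"

definition div_rho_beta ::
  "(cell_state \<Rightarrow> real) \<Rightarrow> ('c, 'n) mesh \<Rightarrow> ('n \<Rightarrow> real^2) \<Rightarrow> ('c \<Rightarrow> cell_state) \<Rightarrow> 'n \<Rightarrow> real" where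
  "div_rho_beta E M x u p = int_dual_div M x (\<lambda>c. rho (u c) *\<^sub>R bet E (u c)) p"

definition delta ::
  "(cell_state \<Rightarrow> real) \<Rightarrow> ('c, 'n) mesh \<Rightarrow> ('n \<Rightarrow> real^2) \<Rightarrow> ('c \<Rightarrow> cell_state) \<Rightarrow> 'n \<Rightarrow> real" where
  "delta E M x u p =
     (\<Sum>c\<in>cells_at M p. clen M x c p * (norm (vel (u c) - vel_p M x u p))\<^sup>2)
     + (div_rho_beta E M x u p)\<^sup>2"

definition nu ::
  "(cell_state \<Rightarrow> real) \<Rightarrow> ('c, 'n) mesh \<Rightarrow> ('n \<Rightarrow> real^2) \<Rightarrow> ('c \<Rightarrow> cell_state) \<Rightarrow> 'n \<Rightarrow> real" where
  "nu E M x u p =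
     (\<Sum>c\<in>cells_at M p. \<Sum>k\<in>UNIV. cnormal M x c p $ k *
        (pres E (u c) * vel (u c) $ k - pres E (u c) * vel_p M x u p $ k
           - pres_p E M x u p * vel (u c) $ k
         + (\<Sum>i\<in>UNIV. stress E (u c) $ i $ k * vel (u c) $ i
              - stress E (u c) $ i $ k * vel_p M x u p $ i
              - stress_p E M x u p $ i $ k * vel (u c) $ i)
         + temp E (u c) * rho (u c) * bet E (u c) $ k
           - temp E (u c) * rho_p M x u p * bet_p E M x u p $ k
           - temp_p E M x u p * rho (u c) * bet E (u c) $ k))"

definition alpha ::
  "(cell_state \<Rightarrow> real) \<Rightarrow> ('c, 'n) mesh \<Rightarrow> ('n \<Rightarrow> real^2) \<Rightarrow> ('c \<Rightarrow> cell_state) \<Rightarrow> 'n \<Rightarrow> real" where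
  "alpha E M x u p = (if delta E M x u p = 0 then 0 else nu E M x u p / delta E M x u p)"

text \<open>The numerical entropy production in a cell; \<open>eps p\<close> is the numerical viscosity at a node.\<close>

definition visc_prod ::
  "(cell_state \<Rightarrow> real) \<Rightarrow> ('c, 'n) mesh \<Rightarrow> ('n \<Rightarrow> real) \<Rightarrow> ('n \<Rightarrow> real^2)
     \<Rightarrow> ('c \<Rightarrow> cell_state) \<Rightarrow> 'c \<Rightarrow> real" where
  "visc_prod E M eps x u c =
     (\<Sum>p\<in>verts M c. subcell_area M x c p / area M x c * (eps p * delta E M x u p / temp E (u c)))"

text \<open>
  The entropy production by relaxation. The coefficient \<open>\<kappa>\<close> stands for the inverse of the second
  relaxation function \<open>\<theta>\<^sub>2\<close>, so that an infinite relaxation time corresponds to \<open>\<kappa> = 0\<close>.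
\<close>

definition relax_prod :: "(cell_state \<Rightarrow> real) \<Rightarrow> real \<Rightarrow> real \<Rightarrow> cell_state \<Rightarrow> real" where
  "relax_prod E \<theta> \<kappa> u =
     (\<Sum>i\<in>UNIV. \<Sum>k\<in>UNIV. Gam E u $ i $ k * Gam E u $ i $ k) / (temp E u * \<theta>)
     + \<kappa> * (bet E u \<bullet> bet E u) / temp E u"


section \<open>The semi-discrete Lagrangian scheme\<close>

text \<open>
  \<open>x t p\<close> is the position of a node, \<open>U t c\<close> the state of a cell, and \<open>dU t c\<close> collects the time
  derivatives of the components of \<open>U\<close> at \<open>t\<close>; \<open>m c\<close> is the (constant) mass of a cell. The time
  interval \<open>I\<close> starts at \<open>0\<close> and may be open or closed at its other end, or unbounded. No time
  discretization enters: a solution satisfies the differential equations exactly.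
  Nonnegativity of the right-hand side of the entropy equation is not listed, since it follows
  from \<open>eps\<close> being nonnegative and the temperature and the relaxation functions being positive.
\<close>

locale htc_scheme =
  fixes M :: "('c, 'n) mesh"
    and E1 :: "real \<Rightarrow> real \<Rightarrow> real"
    and cs ch :: real
    and \<theta>\<^sub>1 :: "real \<Rightarrow> real"
    and \<tau>\<^sub>1 :: real
    and \<kappa>\<^sub>2 :: real
    and eps :: "real \<Rightarrow> 'n \<Rightarrow> real"
    and m :: "'c \<Rightarrow> real"
    and I :: "real set"
    and x :: "real \<Rightarrow> 'n \<Rightarrow> real^2"
    and U dU :: "real \<Rightarrow> 'c \<Rightarrow> cell_state"
    and E :: "cell_state \<Rightarrow> real"
  defines "E \<equiv> energy E1 cs ch"
  assumes time_interval: "is_interval I" "0 \<in> I" "I \<subseteq> {0..}"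
    and eos_convex: "convex_on ({0<..} \<times> UNIV) (\<lambda>(\<tau>, S). E1 \<tau> S)"
    and eos_diff: "(\<lambda>(\<tau>, S). E1 \<tau> S) differentiable_on ({0<..} \<times> UNIV)"
    and relaxation: "\<tau>\<^sub>1 > 0" "\<theta>\<^sub>1 \<tau>\<^sub>1 > 0" "\<kappa>\<^sub>2 \<ge> 0"
    and eps_nonneg: "\<And>t p. t \<in> I \<Longrightarrow> p \<in> nodes M \<Longrightarrow> eps t p \<ge> 0"
    and mesh: "\<And>t. t \<in> I \<Longrightarrow> triangular_mesh M (x t)"
    and spec_vol_pos: "\<And>t c. t \<in> I \<Longrightarrow> c \<in> cells M \<Longrightarrow> spec_vol (U t c) > 0"
    and temp_pos: "\<And>t c. t \<in> I \<Longrightarrow> c \<in> cells M \<Longrightarrow> temp E (U t c) > 0"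
    and mass: "\<And>t c. t \<in> I \<Longrightarrow> c \<in> cells M \<Longrightarrow> m c = rho (U t c) * area M (x t) c"
    and node_motion: "\<And>t p. t \<in> I \<Longrightarrow> p \<in> nodes M \<Longrightarrow>
        ((\<lambda>s. x s p) has_vector_derivative planar (vel_p M (x t) (U t) p)) (at t within I)"
    and derivatives: "\<And>t c. t \<in> I \<Longrightarrow> c \<in> cells M \<Longrightarrow>
        ((\<lambda>s. spec_vol (U s c)) has_real_derivative spec_vol (dU t c)) (at t within I) \<and>
        ((\<lambda>s. vel (U s c)) has_vector_derivative vel (dU t c)) (at t within I) \<and>
        ((\<lambda>s. entropy (U s c)) has_real_derivative entropy (dU t c)) (at t within I) \<and>
        ((\<lambda>s. distortion (U s c)) has_vector_derivative distortion (dU t c)) (at t within I) \<and>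
        ((\<lambda>s. impulse (U s c)) has_vector_derivative impulse (dU t c)) (at t within I)"
    and volume_eq: "\<And>t c. t \<in> I \<Longrightarrow> c \<in> cells M \<Longrightarrow>
        m c * spec_vol (dU t c)
          - (\<Sum>p\<in>verts M c. cnormal M (x t) c p \<bullet> (vel_p M (x t) (U t) p - vel (U t c))) = 0"
    and velocity_eq: "\<And>t c i. t \<in> I \<Longrightarrow> c \<in> cells M \<Longrightarrow>
        m c * vel (dU t c) $ i
          + (\<Sum>p\<in>verts M c.
               cnormal M (x t) c p $ i * (pres_p E M (x t) (U t) p - pres E (U t c))
               + (\<Sum>k\<in>UNIV. cnormal M (x t) c p $ k *
                    (stress_p E M (x t) (U t) p $ i $ k - stress E (U t c) $ i $ k)))
          + (\<Sum>p\<in>verts M c. clen M (x t) c p * (alpha E M (x t) (U t) p + eps t p) *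
               (vel (U t c) $ i - vel_p M (x t) (U t) p $ i)) = 0"
    and entropy_eq: "\<And>t c. t \<in> I \<Longrightarrow> c \<in> cells M \<Longrightarrow>
        m c * entropy (dU t c)
          + (\<Sum>p\<in>verts M c. cnormal M (x t) c p \<bullet>
               (rho_p M (x t) (U t) p *\<^sub>R bet_p E M (x t) (U t) p
                  - rho (U t c) *\<^sub>R bet E (U t c)))
          = visc_prod E M (eps t) (x t) (U t) c + relax_prod E (\<theta>\<^sub>1 \<tau>\<^sub>1) \<kappa>\<^sub>2 (U t c)"
    and distortion_eq: "\<And>t c i k. t \<in> I \<Longrightarrow> c \<in> cells M \<Longrightarrow>
        m c * distortion (dU t c) $ i $ k
          + (\<Sum>l\<in>UNIV. rho (U t c) * distortion (U t c) $ i $ l *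
               (\<Sum>p\<in>verts M c. cnormal M (x t) c p $ k *
                  (vel_p M (x t) (U t) p $ l - vel (U t c) $ l)))
          = - (1 / \<theta>\<^sub>1 \<tau>\<^sub>1) * Gam E (U t c) $ i $ k"
    and impulse_eq: "\<And>t c i. t \<in> I \<Longrightarrow> c \<in> cells M \<Longrightarrow>
        m c * impulse (dU t c) $ i
          + (\<Sum>l\<in>UNIV. rho (U t c) * impulse (U t c) $ l *
               (\<Sum>p\<in>verts M c. cnormal M (x t) c p $ i *
                  (vel_p M (x t) (U t) p $ l - vel (U t c) $ l)))
          + rho (U t c) * (\<Sum>p\<in>verts M c. cnormal M (x t) c p $ i *
               (temp_p E M (x t) (U t) p - temp E (U t c)))
          + rho (U t c) * (\<Sum>p\<in>verts M c. cnormal M (x t) c p $ i *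
               (alpha E M (x t) (U t) p + eps t p) * div_rho_beta E M (x t) (U t) p)
          = - \<kappa>\<^sub>2 * bet E (U t c) $ i"

end

theory Submission
  imports Defs
begin

text \<open>
  Let \<open>J\<close> be the impulse of a cell with an edge from \<open>p\<close> to \<open>q\<close>. The discrete gradient is exact
  along edges, so the evolution equation together with the motion of the nodes makes
  \<open>J \<bullet> (x\<^sub>q - x\<^sub>p)\<close> change at a rate that is a difference of nodal quantities, the same for both
  cells at the edge. Hence the jump of the tangential component across every edge is constant in
  time, and it vanishes initially. The discrete curl at an interior node is a signed sum of these
  jumps. Comparing cells instead of constructing a potential at later times avoids any
  integrability assumption on the numerical viscosity and the correction factor.
\<close>

section \<open>Planar vectors: determinant, rotation by a right angle, collinearity\<close>

definition cross2 :: "real^2 \<Rightarrow> real^2 \<Rightarrow> real" where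
  "cross2 u v = u$1 * v$2 - u$2 * v$1"

text \<open>Clockwise rotation by a right angle: it turns an edge traversed counterclockwise around
  a triangle into an outward normal.\<close>

definition perp :: "real^2 \<Rightarrow> real^2" where
  "perp e = vector [e$2, - e$1]"

lemma perp_nth [simp]: "perp e $ 1 = e$2" "perp e $ 2 = - e$1"
  by (simp_all add: perp_def vector_2)

lemma inner_2: "u \<bullet> v = u$1 * v$1 + u$2 * v$2" for u v :: "real^2"
  by (simp add: inner_vec_def sum_2)

lemma pad_nth [simp]: "pad v $ 1 = v$1" "pad v $ 2 = v$2" "pad v $ 3 = 0"
  by (simp_all add: pad_def vector_3)

lemma planar_nth [simp]: "planar v $ 1 = v$1" "planar v $ 2 = v$2"
  by (simp_all add: planar_def vector_2)

lemma bounded_linear_planar: "bounded_linear planar"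
  by (rule linear_conv_bounded_linear[THEN iffD1], rule linearI)
     (simp_all add: vec_eq_iff forall_2)

lemma cross2_eq_0_iff_collinear:
  "cross2 (b - a) (c - a) = 0 \<longleftrightarrow> collinear {a, b, c}"
proof
  assume "collinear {a, b, c}"
  then show "cross2 (b - a) (c - a) = 0"
    unfolding collinear_3_expand
    by (auto simp: cross2_def) (simp add: algebra_simps)
next
  assume *: "cross2 (b - a) (c - a) = 0"
  show "collinear {a, b, c}"
  proof (cases "a = c")
    case False
    define e where "e = c - a"
    have "e \<bullet> e \<noteq> 0" using False by (simp add: e_def)
    have k: "(b - a)$1 * e$2 = (b - a)$2 * e$1" using * by (simp add: cross2_def e_def)
    \<comment> \<open>A vanishing determinant makes \<open>b - a\<close> equal to its orthogonal
      projection onto \<open>e\<close>.\<close>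
    have "b - a = (((b - a) \<bullet> e) / (e \<bullet> e)) *\<^sub>R e"
      using \<open>e \<bullet> e \<noteq> 0\<close> k unfolding vec_eq_iff forall_2
      by (simp add: inner_2 field_simps) algebra
    then have "b = (1 - ((b - a) \<bullet> e) / (e \<bullet> e)) *\<^sub>R a + (1 - (1 - ((b - a) \<bullet> e) / (e \<bullet> e))) *\<^sub>R c"
      unfolding e_def by (simp add: algebra_simps)
    then show ?thesis unfolding collinear_3_expand by blast
  qed (simp add: insert_commute)
qed

section \<open>Geometry of a single triangle and of two triangles at an edge\<close>

text \<open>Orthogonality to the edge leaves the multiples of \<open>perp (b - a)\<close>, unit
  length fixes the modulus, and the opposite vertex fixes the sign. The equivalence gives existence
  and uniqueness at once, as needed to evaluate the \<open>THE\<close> in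
  \<open>edge_normal\<close>.\<close>

lemma outward_unit_normal_eq:
  fixes a b c n :: "real^2"
  assumes nc: "\<not> collinear {a, b, c}"
  defines "d \<equiv> cross2 (b - a) (c - a)"
  shows "norm n = 1 \<and> n \<bullet> (b - a) = 0 \<and> (\<forall>y\<in>convex hull {a, b, c}. n \<bullet> (y - a) \<le> 0)
    \<longleftrightarrow> n = (sgn d / dist a b) *\<^sub>R perp (b - a)"
proof -
  have d: "d \<noteq> 0" using nc by (simp add: d_def cross2_eq_0_iff_collinear)
  define e where "e = b - a"
  have e0: "e \<noteq> 0" using d by (auto simp: e_def d_def cross2_def)
  have dist: "dist a b = norm e" by (simp add: e_def dist_norm norm_minus_commute)
  have pn: "norm (perp e) = norm e"
    by (simp add: norm_eq_sqrt_inner inner_2 add.commute)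
  have ne: "norm e > 0" using e0 by simp
  show ?thesis
  proof
    assume n: "norm n = 1 \<and> n \<bullet> (b - a) = 0 \<and> (\<forall>y\<in>convex hull {a, b, c}. n \<bullet> (y - a) \<le> 0)"
    define l where "l = (n \<bullet> perp e) / (e \<bullet> e)"
    have ee: "e \<bullet> e \<noteq> 0" using e0 by simp
    have "n$1 * e$1 + n$2 * e$2 = 0" using n by (simp add: inner_2 e_def)
    then have nl: "n = l *\<^sub>R perp e"
      unfolding vec_eq_iff forall_2 l_def using ee
      by (simp add: inner_2 field_simps) algebra
    have "c \<in> convex hull {a, b, c}" by (simp add: hull_inc)
    then have "n \<bullet> (c - a) \<le> 0" using n by blast
    then have ld: "l * d \<ge> 0"
      by (simp add: nl d_def cross2_def inner_2 e_def algebra_simps)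
    have "norm n = \<bar>l\<bar> * norm e" by (simp add: nl pn)
    then have "\<bar>l\<bar> = 1 / norm e" using n ne by (simp add: field_simps)
    then have "l = sgn d / norm e"
      using ld d ne by (cases "d > 0") (auto simp: zero_le_mult_iff abs_if split: if_splits)
    then show "n = (sgn d / dist a b) *\<^sub>R perp (b - a)" using nl by (simp add: dist e_def)
  next
    assume n: "n = (sgn d / dist a b) *\<^sub>R perp (b - a)"
    then have n': "n = (sgn d / norm e) *\<^sub>R perp e" by (simp add: dist e_def)
    have 1: "norm n = 1" using d ne by (simp add: n' pn abs_sgn_eq)
    have 2: "n \<bullet> (b - a) = 0" by (simp add: n' inner_2 e_def[symmetric])
    have "perp e \<bullet> (c - a) = - d"
      by (simp add: d_def cross2_def inner_2 e_def algebra_simps)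
    then have "n \<bullet> (c - a) = - (sgn d * d) / norm e" by (simp add: n')
    also have "\<dots> = - \<bar>d\<bar> / norm e" by (simp add: abs_sgn mult.commute)
    finally have 3: "n \<bullet> (c - a) \<le> 0" using ne by simp
    \<comment> \<open>A half plane is convex, so it suffices to test the three vertices.\<close>
    have "{a, b, c} \<subseteq> {y. n \<bullet> y \<le> n \<bullet> a}" using 2 3 by (auto simp: inner_diff_right)
    then have "convex hull {a, b, c} \<subseteq> {y. n \<bullet> y \<le> n \<bullet> a}"
      by (rule hull_minimal) (rule convex_halfspace_le)
    then have "\<forall>y\<in>convex hull {a, b, c}. n \<bullet> (y - a) \<le> 0"
      by (auto simp: inner_diff_right)
    with 1 2 show "norm n = 1 \<and> n \<bullet> (b - a) = 0 \<and> (\<forall>y\<in>convex hull {a, b, c}. n \<bullet> (y - a) \<le> 0)"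
      by blast
  qed
qed

text \<open>Both triangles contain all points sufficiently close to the midpoint of the common edge on
  the common side.\<close>

lemma same_side_triangles_overlap:
  fixes a b c d :: "real^2"
  assumes same: "sgn (cross2 (b - a) (c - a)) = sgn (cross2 (b - a) (d - a))"
    and nc: "\<not> collinear {a, b, c}" and nd: "\<not> collinear {a, b, d}"
  shows "interior (convex hull {a, b, c}) \<inter> interior (convex hull {a, b, d}) \<noteq> {}"
proof -
  define C where "C = cross2 (b - a) (c - a)"
  define D where "D = cross2 (b - a) (d - a)"
  have CD: "C \<noteq> 0" "D \<noteq> 0" using nc nd by (simp_all add: C_def D_def cross2_eq_0_iff_collinear)
  \<comment> \<open>By Cramer's rule, \<open>s\<close> and \<open>k\<close> are the coordinates of
    \<open>d - a\<close> in the basis \<open>b - a\<close>, \<open>c - a\<close>; positivity of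
    \<open>k\<close> says that \<open>c\<close> and \<open>d\<close> lie on the same side.\<close>
  define k where "k = D / C"
  define s where "s = cross2 (d - a) (c - a) / C"
  have k: "k > 0"
    using CD same by (auto simp: k_def C_def[symmetric] D_def[symmetric] zero_less_divide_iff sgn_if split: if_splits)
  have dd: "d - a = s *\<^sub>R (b - a) + k *\<^sub>R (c - a)"
    using CD(1) unfolding vec_eq_iff forall_2 s_def k_def D_def
    by (simp add: field_simps) (simp add: C_def cross2_def algebra_simps)
  \<comment> \<open>So small that the barycentric coordinates of \<open>y\<close> stay positive in
    both triangles: those of \<open>a\<close> and \<open>b\<close> differ from 1/2 by at most
    1/4.\<close>
  define h where "h = 1 / (4 * (1 + \<bar>s\<bar> + k))"
  have h: "h > 0" using k by (simp add: h_def)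
  have h1: "h * (1 + \<bar>s\<bar> + k) = 1/4" using k by (simp add: h_def)
  have hs: "h + \<bar>h * s\<bar> + h * k = 1/4" using h1 h by (simp add: abs_mult algebra_simps)
  have hk: "h * k > 0" using h k by simp
  define y where "y = a + (1/2) *\<^sub>R (b - a) + h *\<^sub>R (d - a)"
  have DIM: "DIM(real^2) = 2" by simp
  have "y = (1/2 - h) *\<^sub>R a + (1/2) *\<^sub>R b + h *\<^sub>R d"
    unfolding y_def vec_eq_iff forall_2 by (simp add: algebra_simps)
  moreover have "1/2 - h > 0" using hs hk by linarith
  ultimately have 1: "y \<in> interior (convex hull {a, b, d})"
    unfolding interior_convex_hull_3_minimal[OF nd DIM] mem_Collect_eq using h
    by (intro exI[of _ "1/2 - h"] exI[of _ "1/2"] exI[of _ h]) auto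
  have "y = (1/2 - h * s - h * k) *\<^sub>R a + (1/2 + h * s) *\<^sub>R b + (h * k) *\<^sub>R c"
    unfolding y_def dd vec_eq_iff forall_2 by (simp add: algebra_simps)
  moreover have "1/2 - h * s - h * k > 0" "1/2 + h * s > 0" using hs hk h by linarith+
  ultimately have 2: "y \<in> interior (convex hull {a, b, c})"
    unfolding interior_convex_hull_3_minimal[OF nc DIM] mem_Collect_eq using hk
    by (intro exI[of _ "1/2 - h * s - h * k"] exI[of _ "1/2 + h * s"] exI[of _ "h * k"]) auto
  from 1 2 show ?thesis by blast
qed

text \<open>The half lengths cancel the normalisation of the edge normals, and the two rotated edges
  at \<open>p\<close>, taken with opposite signs, combine to the rotated opposite edge.\<close>

lemma triangle_cnormal:
  assumes v: "verts M c = {p, q, r}" and ne: "p \<noteq> q" "q \<noteq> r" "p \<noteq> r"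
    and nc: "\<not> collinear {x p, x q, x r}"
  shows "cnormal M x c p = pad ((sgn (cross2 (x q - x p) (x r - x p)) / 2) *\<^sub>R perp (x q - x r))"
proof -
  let ?d = "cross2 (x q - x p) (x r - x p)"
  have nc': "\<not> collinear {x p, x r, x q}" using nc by (simp add: insert_commute)
  have d': "cross2 (x r - x p) (x q - x p) = - ?d" by (simp add: cross2_def)
  have "dist (x p) (x q) \<noteq> 0" "dist (x p) (x r) \<noteq> 0"
    using nc by (auto simp: insert_commute)
  moreover have "edge_normal M x c p q = (sgn ?d / dist (x p) (x q)) *\<^sub>R perp (x q - x p)"
    unfolding edge_normal_def tri_def v image_insert image_empty outward_unit_normal_eq[OF nc]
    by simp
  moreover have "edge_normal M x c p r = (- sgn ?d / dist (x p) (x r)) *\<^sub>R perp (x r - x p)"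
    unfolding edge_normal_def tri_def v image_insert image_empty
      insert_commute[of "x q"] outward_unit_normal_eq[OF nc'] d'
    by (simp add: sgn_minus)
  moreover have "verts M c - {p} = {q, r}" using v ne by auto
  ultimately show ?thesis
    using ne unfolding cnormal_def
    by (simp add: vec_eq_iff forall_3 field_simps)
qed

lemma triangle_area:
  assumes v: "verts M c = {p, q, r}"
  shows "area M x c = \<bar>cross2 (x q - x p) (x r - x p)\<bar> / 2"
proof -
  \<comment> \<open>The hull is a Borel set, so \<open>lebesgue\<close> and \<open>lborel\<close>
    give it the same measure.\<close>
  have "convex hull {x p, x q, x r} \<in> sets borel"
    by (intro borel_closed compact_imp_closed compact_convex_hull) simp
  then have "area M x c = measure lborel (convex hull {x p, x q, x r})"
    by (simp add: area_def tri_def v)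
  also have "\<dots> = \<bar>cross2 (x q - x p) (x r - x p)\<bar> / 2"
    unfolding content_triangle cross2_def by (simp add: abs_if algebra_simps)
  finally show ?thesis .
qed

lemma triangular_meshE:
  assumes "triangular_mesh M x" "c \<in> cells M" "p \<in> verts M c" "q \<in> verts M c" "p \<noteq> q"
  obtains r where "verts M c = {p, q, r}" "q \<noteq> r" "p \<noteq> r" "\<not> collinear {x p, x q, x r}"
proof -
  have "card (verts M c) = 3" and nc: "\<not> collinear (x ` verts M c)"
    using assms(1,2) by (auto simp: triangular_mesh_def)
  then have f: "finite (verts M c)" "card (verts M c - {p, q}) = 1"
    using assms(3-5) card_ge_0_finite[of "verts M c"] by (auto simp: card_Diff_subset)
  then obtain r where "verts M c - {p, q} = {r}" by (auto simp: card_1_singleton_iff)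
  then have "verts M c = {p, q, r}" "q \<noteq> r" "p \<noteq> r" using assms(3,4) by auto
  with nc that show thesis by auto
qed

lemma triangular_mesh_cellE:
  assumes "triangular_mesh M x" "c \<in> cells M"
  obtains p q r where "verts M c = {p, q, r}" "p \<noteq> q" "q \<noteq> r" "p \<noteq> r" "\<not> collinear {x p, x q, x r}"
proof -
  have "card (verts M c) = 3" and nc: "\<not> collinear (x ` verts M c)"
    using assms by (auto simp: triangular_mesh_def)
  with that show thesis unfolding card_3_iff by auto
qed

text \<open>Cyclic relabelling preserves the signed area, so the three corner normals share one
  factor \<open>s\<close>.\<close>

lemma cnormals_of_triangle:
  assumes v: "verts M c = {p, q, r}" and ne: "p \<noteq> q" "q \<noteq> r" "p \<noteq> r"
    and nc: "\<not> collinear {x p, x q, x r}"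
  defines "s \<equiv> sgn (cross2 (x q - x p) (x r - x p)) / 2"
  shows "cnormal M x c p = pad (s *\<^sub>R perp (x q - x r))"
    and "cnormal M x c q = pad (s *\<^sub>R perp (x r - x p))"
    and "cnormal M x c r = pad (s *\<^sub>R perp (x p - x q))"
proof -
  have "verts M c = {q, r, p}" "verts M c = {r, p, q}"
    and "\<not> collinear {x q, x r, x p}" "\<not> collinear {x r, x p, x q}"
    using v nc by (auto simp: insert_commute)
  moreover have "cross2 (x r - x q) (x p - x q) = cross2 (x q - x p) (x r - x p)"
    "cross2 (x p - x r) (x q - x r) = cross2 (x q - x p) (x r - x p)"
    by (simp_all add: cross2_def algebra_simps)
  ultimately show "cnormal M x c p = pad (s *\<^sub>R perp (x q - x r))"
    and "cnormal M x c q = pad (s *\<^sub>R perp (x r - x p))"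
    and "cnormal M x c r = pad (s *\<^sub>R perp (x p - x q))"
    using triangle_cnormal[of M c p q r x] triangle_cnormal[of M c q r p x]
      triangle_cnormal[of M c r p q x] v ne nc
    by (simp_all add: s_def)
qed

text \<open>The edges of a triangle close up, and so do their rotations. This later removes the cell
  values from the impulse equation.\<close>

lemma sum_cnormal_eq_0:
  assumes "triangular_mesh M x" "c \<in> cells M"
  shows "(\<Sum>p\<in>verts M c. cnormal M x c p) = 0"
proof -
  obtain p q r where t: "verts M c = {p, q, r}" "p \<noteq> q" "q \<noteq> r" "p \<noteq> r"
    "\<not> collinear {x p, x q, x r}"
    using assms by (rule triangular_mesh_cellE)
  show ?thesis
    using t(2-4) unfolding cnormals_of_triangle[OF t] t(1)
    by (simp add: cnormals_of_triangle[OF t] vec_eq_iff forall_3 algebra_simps diff_divide_distrib)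
qed

lemma area_pos:
  assumes "triangular_mesh M x" "c \<in> cells M"
  shows "area M x c > 0"
proof -
  obtain p q r where t: "verts M c = {p, q, r}" "p \<noteq> q" "q \<noteq> r" "p \<noteq> r"
    "\<not> collinear {x p, x q, x r}"
    using assms by (rule triangular_mesh_cellE)
  then show ?thesis by (simp add: triangle_area[OF t(1)] cross2_eq_0_iff_collinear)
qed

section \<open>Exactness of the discrete gradient along edges\<close>

lemma disc_grad_third [simp]: "disc_grad M x f c $ 3 = 0"
  by (simp add: disc_grad_def cnormal_def)

text \<open>The corner normal at the third vertex is orthogonal to the edge, while those at
  \<open>q\<close> and \<open>p\<close> have inner products plus and minus the area with it.\<close>

lemma disc_grad_edge:
  assumes "triangular_mesh M x" "c \<in> cells M" "p \<in> verts M c" "q \<in> verts M c"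
  shows "planar (disc_grad M x f c) \<bullet> (x q - x p) = f q - f p"
proof (cases "p = q")
  case False
  with assms obtain r where t: "verts M c = {p, q, r}" "q \<noteq> r" "p \<noteq> r"
    "\<not> collinear {x p, x q, x r}"
    by (rule triangular_meshE)
  let ?d = "cross2 (x q - x p) (x r - x p)"
  note N = cnormals_of_triangle[OF t(1) False t(2-4)]
  have d: "?d \<noteq> 0" using t(4) by (simp add: cross2_eq_0_iff_collinear)
  have "planar (disc_grad M x f c) \<bullet> (x q - x p) = (sgn ?d / \<bar>?d\<bar>) * (?d * (f q - f p))"
    unfolding disc_grad_def triangle_area[OF t(1)] t(1) using False t(2,3)
    by (simp add: N inner_2) (simp add: cross2_def algebra_simps add_divide_distrib diff_divide_distrib)
  also have "sgn ?d / \<bar>?d\<bar> = 1 / ?d" using d by (simp add: sgn_if)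
  finally show ?thesis using d by simp
qed simp

section \<open>Orientation of edges and the dual curl\<close>

text \<open>The side of the directed edge from \<open>p\<close> to \<open>q\<close> on which the
  cell lies. Summing over all vertices avoids naming the third one, since \<open>p\<close> and
  \<open>q\<close> contribute zero.\<close>

definition orient :: "('c, 'n) mesh \<Rightarrow> ('n \<Rightarrow> real^2) \<Rightarrow> 'c \<Rightarrow> 'n \<Rightarrow> 'n \<Rightarrow> real" where
  "orient M x c p q = sgn (\<Sum>v\<in>verts M c. cross2 (x q - x p) (x v - x p))"

lemma orient_triangle:
  assumes "verts M c = {p, q, r}" "p \<noteq> q" "q \<noteq> r" "p \<noteq> r"
  shows "orient M x c p q = sgn (cross2 (x q - x p) (x r - x p))"
  using assms by (simp add: orient_def cross2_def)

text \<open>The cross product of a rotated planar vector with \<open>J\<close> is an inner product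
  in the third component. The opposite edge is the difference of the two edges at \<open>p\<close>,
  so the corner term splits into one contribution per edge.\<close>

lemma corner_curl:
  assumes "triangular_mesh M x" "c \<in> cells M" "p \<in> verts M c" and J: "J $ 3 = 0"
  shows "cross3 (cnormal M x c p) J =
    (\<Sum>q\<in>verts M c - {p}. orient M x c p q *\<^sub>R axis 3 (planar J \<bullet> (x q - x p) / 2))"
proof -
  obtain q r where t: "verts M c = {p, q, r}" "p \<noteq> q" "q \<noteq> r" "p \<noteq> r"
    "\<not> collinear {x p, x q, x r}"
  proof -
    obtain p' q' r' where "verts M c = {p', q', r'}" "p' \<noteq> q'"
      using assms(1,2) by (rule triangular_mesh_cellE)
    then obtain q where "q \<in> verts M c" "p \<noteq> q" by auto
    with assms(1-3) that show thesis by (metis triangular_meshE)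
  qed
  let ?s = "sgn (cross2 (x q - x p) (x r - x p))"
  have "verts M c = {p, r, q}" using t(1) by auto
  then have "orient M x c p r = sgn (cross2 (x r - x p) (x q - x p))"
    using t(2-4) by (intro orient_triangle) auto
  also have "\<dots> = sgn (- cross2 (x q - x p) (x r - x p))"
    by (rule arg_cong[where f = sgn]) (simp add: cross2_def)
  finally have r: "orient M x c p r = - ?s" by (simp add: sgn_minus)
  have q: "orient M x c p q = ?s" using t(1-4) by (rule orient_triangle)
  have "verts M c - {p} = {q, r}" using t by auto
  then show ?thesis
    using t(3) J by (simp add: triangle_cnormal[OF t] q r)
      (simp add: cross3_def vec_eq_iff forall_3 axis_def vector_3 inner_2 algebra_simps
        add_divide_distrib diff_divide_distrib)
qed

text \<open>Two distinct cells on the same side of a shared edge would have overlapping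
  interiors.\<close>

lemma orient_inj:
  assumes m: "triangular_mesh M x" and c: "c \<in> cells M" "p \<in> verts M c" "q \<in> verts M c"
    and c': "c' \<in> cells M" "p \<in> verts M c'" "q \<in> verts M c'"
    and "p \<noteq> q" and eq: "orient M x c p q = orient M x c' p q"
  shows "c = c'"
proof (rule ccontr)
  assume "c \<noteq> c'"
  obtain r where r: "verts M c = {p, q, r}" "q \<noteq> r" "p \<noteq> r" "\<not> collinear {x p, x q, x r}"
    using m c \<open>p \<noteq> q\<close> by (rule triangular_meshE)
  obtain r' where r': "verts M c' = {p, q, r'}" "q \<noteq> r'" "p \<noteq> r'" "\<not> collinear {x p, x q, x r'}"
    using m c' \<open>p \<noteq> q\<close> by (rule triangular_meshE)
  have "interior (tri M x c) \<inter> interior (tri M x c') \<noteq> {}"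
    using same_side_triangles_overlap[OF _ r(4) r'(4)] eq \<open>p \<noteq> q\<close>
    by (simp add: tri_def r(1) r'(1) orient_triangle[OF r(1) \<open>p \<noteq> q\<close> r(2,3)]
        orient_triangle[OF r'(1) \<open>p \<noteq> q\<close> r'(2,3)])
  with m c(1) c'(1) \<open>c \<noteq> c'\<close> show False unfolding triangular_mesh_def by blast
qed

lemma orient_cases:
  assumes "triangular_mesh M x" "c \<in> cells M" "p \<in> verts M c" "q \<in> verts M c" "p \<noteq> q"
  shows "orient M x c p q = 1 \<or> orient M x c p q = - 1"
proof -
  obtain r where r: "verts M c = {p, q, r}" "q \<noteq> r" "p \<noteq> r" "\<not> collinear {x p, x q, x r}"
    using assms by (rule triangular_meshE)
  then show ?thesis
    by (simp add: orient_triangle[OF r(1) assms(5) r(2,3)] cross2_eq_0_iff_collinear[symmetric]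
        sgn_if)
qed

text \<open>Interiority supplies a second cell at the edge. Orientations are plus or minus one and
  differ between distinct cells, so there are exactly two cells, with opposite signs.\<close>

lemma sum_orient_interior_edge:
  assumes m: "triangular_mesh M x" and p: "interior_node M p"
    and c: "c \<in> cells_at M p" "q \<in> verts M c" and ne: "p \<noteq> q"
  shows "(\<Sum>c | c \<in> cells_at M p \<and> q \<in> verts M c. orient M x c p q) = 0"
proof -
  let ?S = "{c \<in> cells_at M p. q \<in> verts M c}"
  obtain c' where c': "c' \<in> cells_at M p" "c' \<noteq> c" "q \<in> verts M c'"
    using p c ne unfolding interior_node_def by blast
  have inj: "d = d'" if "d \<in> ?S" "d' \<in> ?S" "orient M x d p q = orient M x d' p q" for d d'
    using that ne orient_inj[OF m, of d p q d'] by (auto simp: cells_at_def)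
  have cs: "orient M x d p q = 1 \<or> orient M x d p q = - 1" if "d \<in> ?S" for d
    using that ne orient_cases[OF m, of d p q] by (auto simp: cells_at_def)
  have S: "c \<in> ?S" "c' \<in> ?S" using c c' by auto
  have opp: "orient M x c' p q = - orient M x c p q"
    using inj[OF S] cs[OF S(1)] cs[OF S(2)] c'(2) by auto
  have "?S = {c, c'}"
  proof
    show "?S \<subseteq> {c, c'}"
    proof
      fix d assume d: "d \<in> ?S"
      show "d \<in> {c, c'}"
        using inj[OF d S(1)] inj[OF d S(2)] cs[OF d] cs[OF S(1)] opp by auto
    qed
  qed (use S in blast)
  then show ?thesis using opp c'(2) by simp
qed

text \<open>The dual curl at an interior node only sees the jumps of the tangential components across
  edges, because each edge is traversed in opposite directions by its two cells.\<close>

lemma dual_curl_eq_0: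
  assumes m: "triangular_mesh M x" and p: "interior_node M p"
    and J3: "\<And>c. c \<in> cells_at M p \<Longrightarrow> J c $ 3 = 0"
    and tang: "\<And>c c' q. c \<in> cells_at M p \<Longrightarrow> c' \<in> cells_at M p \<Longrightarrow> q \<in> verts M c \<Longrightarrow> q \<in> verts M c' \<Longrightarrow>
      planar (J c) \<bullet> (x q - x p) = planar (J c') \<bullet> (x q - x p)"
  shows "dual_curl M x J p = 0"
proof -
  let ?C = "cells_at M p"
  define Q where "Q = (\<Union>c\<in>?C. verts M c) - {p}"
  let ?h = "\<lambda>c q. orient M x c p q *\<^sub>R axis 3 (planar (J c) \<bullet> (x q - x p) / 2) :: real^3"
  have finC: "finite ?C"
    using m p by (simp add: triangular_mesh_def interior_node_def)
  have fv: "finite (verts M c)" if "c \<in> ?C" for c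
    using m that card_ge_0_finite[of "verts M c"] by (auto simp: triangular_mesh_def cells_at_def)
  then have finQ: "finite Q" using finC by (simp add: Q_def)
  have zero: "(\<Sum>c | c \<in> ?C \<and> q \<in> verts M c. ?h c q) = 0" if q: "q \<in> Q" for q
  proof -
    obtain d where d: "d \<in> ?C" "q \<in> verts M d" and "p \<noteq> q" using q by (auto simp: Q_def)
    \<comment> \<open>By \<open>tang\<close> the tangential component of one cell \<open>d\<close>
      serves all cells at the edge and can be factored out of the sum of orientations.\<close>
    have "(\<Sum>c | c \<in> ?C \<and> q \<in> verts M c. ?h c q) =
        (\<Sum>c | c \<in> ?C \<and> q \<in> verts M c. orient M x c p q *\<^sub>R axis 3 (planar (J d) \<bullet> (x q - x p) / 2))"
      using d by (intro sum.cong refl) (simp, metis tang)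
    also have "\<dots> = 0"
      unfolding scaleR_left.sum[symmetric] sum_orient_interior_edge[OF m p d \<open>p \<noteq> q\<close>] by simp
    finally show ?thesis .
  qed
  have "(\<Sum>c\<in>?C. cross3 (cnormal M x c p) (J c)) = (\<Sum>c\<in>?C. \<Sum>q\<in>verts M c - {p}. ?h c q)"
    using J3 by (intro sum.cong refl corner_curl[OF m]) (auto simp: cells_at_def)
  also have "\<dots> = (\<Sum>c\<in>?C. \<Sum>q | q \<in> Q \<and> q \<in> verts M c. ?h c q)"
    by (intro sum.cong) (auto simp: Q_def)
  \<comment> \<open>Summation cell by cell becomes summation edge by edge; \<open>Q\<close> holds
    the far end points of the edges at \<open>p\<close>.\<close>
  also have "\<dots> = (\<Sum>q\<in>Q. \<Sum>c | c \<in> ?C \<and> q \<in> verts M c. ?h c q)"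
    by (rule sum.swap_restrict[OF finC finQ])
  also have "\<dots> = 0" using zero by simp
  finally show ?thesis by (simp add: dual_curl_def)
qed

section \<open>Evolution of the thermal impulse in time\<close>

lemma has_vector_derivative_zero_unique:
  fixes f :: "real \<Rightarrow> 'a::real_normed_vector"
  assumes "convex S" "\<And>s. s \<in> S \<Longrightarrow> (f has_vector_derivative 0) (at s within S)"
    and "s \<in> S" "t \<in> S"
  shows "f s = f t"
  using has_derivative_zero_unique[of S f s t] assms by (simp add: has_vector_derivative_def)

context htc_scheme
begin

text \<open>Minus the rate at which a nodal potential of the impulse would evolve along the moving
  nodes. It depends on the node alone, which makes the tangential rates of neighbouring cells
  agree.\<close>

definition potential_rate :: "real \<Rightarrow> 'n \<Rightarrow> real" where
  "potential_rate t p = temp_p E M (x t) (U t) p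
     + (alpha E M (x t) (U t) p + eps t p) * div_rho_beta E M (x t) (U t) p"

text \<open>The mass is density times area, so the density cancels. The cell values of velocity and
  temperature drop out because the corner normals sum to zero; what remains is a discrete gradient,
  with the impulse of \<open>c\<close> frozen inside it.\<close>

lemma impulse_derivative:
  assumes \<kappa>: "\<kappa>\<^sub>2 = 0" and t: "t \<in> I" and c: "c \<in> cells M"
  shows "impulse (dU t c) =
    - disc_grad M (x t) (\<lambda>p. impulse (U t c) \<bullet> vel_p M (x t) (U t) p + potential_rate t p) c"
proof -
  let ?N = "\<lambda>p. cnormal M (x t) c p" and ?r = "rho (U t c)" and ?J = "impulse (U t c)"
  let ?f = "\<lambda>p. ?J \<bullet> vel_p M (x t) (U t) p + potential_rate t p"
  have r: "?r > 0" using spec_vol_pos[OF t c] by (simp add: rho_def)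
  have a: "area M (x t) c > 0" using mesh[OF t] c by (rule area_pos)
  have N0: "(\<Sum>p\<in>verts M c. ?N p $ i) = 0" for i
    using sum_cnormal_eq_0[OF mesh[OF t] c] by (metis sum_component zero_index)
  have "impulse (dU t c) $ i = - disc_grad M (x t) ?f c $ i" for i
  proof -
    have "(\<Sum>l\<in>UNIV. ?r * ?J $ l * (\<Sum>p\<in>verts M c. ?N p $ i * (vel_p M (x t) (U t) p $ l - vel (U t c) $ l)))
        = (\<Sum>p\<in>verts M c. \<Sum>l\<in>UNIV. ?r * ?J $ l * (?N p $ i * (vel_p M (x t) (U t) p $ l - vel (U t c) $ l)))"
      unfolding sum_distrib_left by (rule sum.swap)
    also have "\<dots> = ?r * (\<Sum>p\<in>verts M c. ?N p $ i * (?J \<bullet> vel_p M (x t) (U t) p - ?J \<bullet> vel (U t c)))"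
      unfolding sum_distrib_left
      by (intro sum.cong refl) (simp add: sum_3 inner_vec_def algebra_simps)
    also have "\<dots> = ?r * (\<Sum>p\<in>verts M c. ?N p $ i * (?J \<bullet> vel_p M (x t) (U t) p))"
      using N0[of i] by (simp add: right_diff_distrib sum_subtractf sum_distrib_right[symmetric])
    finally have 1: "(\<Sum>l\<in>UNIV. ?r * ?J $ l * (\<Sum>p\<in>verts M c. ?N p $ i * (vel_p M (x t) (U t) p $ l - vel (U t c) $ l)))
        = ?r * (\<Sum>p\<in>verts M c. ?N p $ i * (?J \<bullet> vel_p M (x t) (U t) p))" .
    have 2: "(\<Sum>p\<in>verts M c. ?N p $ i * (temp_p E M (x t) (U t) p - temp E (U t c)))
        = (\<Sum>p\<in>verts M c. ?N p $ i * temp_p E M (x t) (U t) p)"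
      using N0[of i] by (simp add: right_diff_distrib sum_subtractf sum_distrib_right[symmetric])
    have "?r * (area M (x t) c * impulse (dU t c) $ i + (\<Sum>p\<in>verts M c. ?N p $ i * ?f p)) = 0"
      using impulse_eq[OF t c, of i] unfolding 1 2 mass[OF t c] \<kappa> potential_rate_def
      by (simp add: distrib_left distrib_right sum.distrib mult.assoc add.assoc)
    then have "area M (x t) c * impulse (dU t c) $ i = - (\<Sum>p\<in>verts M c. ?N p $ i * ?f p)"
      using r by (simp add: eq_neg_iff_add_eq_0)
    then show ?thesis
      using a by (simp add: disc_grad_def field_simps mult.commute)
  qed
  then show ?thesis by (simp add: vec_eq_iff)
qed

text \<open>The time derivative is a discrete gradient, which has no third component.\<close>

lemma impulse_third_eq_0:
  assumes \<kappa>: "\<kappa>\<^sub>2 = 0" and c: "c \<in> cells M" and 0: "impulse (U 0 c) $ 3 = 0" and t: "t \<in> I"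
  shows "impulse (U t c) $ 3 = 0"
proof -
  have "((\<lambda>s. impulse (U s c) $ 3) has_vector_derivative 0) (at s within I)" if s: "s \<in> I" for s
  proof -
    have "((\<lambda>s. impulse (U s c)) has_vector_derivative impulse (dU s c)) (at s within I)"
      using derivatives[OF s c] by blast
    from bounded_linear.has_vector_derivative[OF bounded_linear_vec_nth this, of 3]
    show ?thesis by (simp add: impulse_derivative[OF \<kappa> s c])
  qed
  from has_vector_derivative_zero_unique[OF is_interval_convex[OF time_interval(1)] this t time_interval(2)]
  show ?thesis using 0 by simp
qed

text \<open>The geometric terms cancel and the remaining rate no longer depends on the cell.\<close>

lemma tangential_impulse_derivative:
  assumes \<kappa>: "\<kappa>\<^sub>2 = 0" and c: "c \<in> cells M" and 0: "impulse (U 0 c) $ 3 = 0"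
    and pq: "p \<in> verts M c" "q \<in> verts M c" and t: "t \<in> I"
  shows "((\<lambda>s. planar (impulse (U s c)) \<bullet> (x s q - x s p)) has_vector_derivative
    - (potential_rate t q - potential_rate t p)) (at t within I)"
proof -
  let ?J = "impulse (U t c)"
  let ?v = "vel_p M (x t) (U t)"
  have "((\<lambda>s. impulse (U s c)) has_vector_derivative impulse (dU t c)) (at t within I)"
    using derivatives[OF t c] by blast
  note J' = bounded_linear.has_vector_derivative[OF bounded_linear_planar this]
  have "p \<in> nodes M" "q \<in> nodes M" using c pq by (auto simp: nodes_def)
  note x' = has_vector_derivative_diff[OF node_motion[OF t this(2)] node_motion[OF t this(1)]]
  have neg: "planar (- w) = - planar w" for w by (simp add: vec_eq_iff forall_2)
  \<comment> \<open>The nodes move with the planar velocity, whereas the impulse equation yields an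
    inner product in three dimensions; the two agree because \<open>?J\<close> has no third
    component.\<close>
  have J3: "?J $ 3 = 0" using \<kappa> c 0 t by (rule impulse_third_eq_0)
  have "planar ?J \<bullet> (planar (?v q) - planar (?v p)) = ?J \<bullet> ?v q - ?J \<bullet> ?v p"
    using J3 by (simp add: inner_2 inner_vec_def[where 'b = 3] sum_3 algebra_simps)
  moreover have "planar (impulse (dU t c)) \<bullet> (x t q - x t p)
      = - (?J \<bullet> ?v q + potential_rate t q - (?J \<bullet> ?v p + potential_rate t p))"
    unfolding impulse_derivative[OF \<kappa> t c] neg inner_minus_left disc_grad_edge[OF mesh[OF t] c pq] ..
  ultimately show ?thesis
    using bounded_bilinear.has_vector_derivative[OF bounded_bilinear_inner J' x'] by simp
qed

text \<open>At time 0 both sides equal \<open>Z q - Z p\<close> by exactness of the discrete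
  gradient, and afterwards they change at the same rate.\<close>

lemma tangential_impulse_continuous_across_edge:
  assumes \<kappa>: "\<kappa>\<^sub>2 = 0" and init: "\<And>c. c \<in> cells M \<Longrightarrow> impulse (U 0 c) = disc_grad M (x 0) Z c"
    and c: "c \<in> cells M" "p \<in> verts M c" "q \<in> verts M c"
    and c': "c' \<in> cells M" "p \<in> verts M c'" "q \<in> verts M c'" and t: "t \<in> I"
  shows "planar (impulse (U t c)) \<bullet> (x t q - x t p) = planar (impulse (U t c')) \<bullet> (x t q - x t p)"
proof -
  let ?w = "\<lambda>c s. planar (impulse (U s c)) \<bullet> (x s q - x s p)"
  have "((\<lambda>s. ?w c s - ?w c' s) has_vector_derivative 0) (at s within I)" if s: "s \<in> I" for s
    using has_vector_derivative_diff[OF tangential_impulse_derivative[OF \<kappa> c(1) _ c(2,3) s]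
        tangential_impulse_derivative[OF \<kappa> c'(1) _ c'(2,3) s]] init c(1) c'(1) by simp
  note has_vector_derivative_zero_unique[OF is_interval_convex[OF time_interval(1)] this t time_interval(2)]
  moreover have "?w c 0 - ?w c' 0 = 0"
    using init c c' disc_grad_edge[OF mesh[OF time_interval(2)]] by simp
  ultimately show ?thesis by simp
qed

end

theorem theorem3p5:
  fixes M :: "('c, 'n) mesh"
    and E1 :: "real \<Rightarrow> real \<Rightarrow> real"
    and cs ch \<tau>\<^sub>1 :: real
    and \<theta>\<^sub>1 :: "real \<Rightarrow> real"
    and eps :: "real \<Rightarrow> 'n \<Rightarrow> real"
    and m :: "'c \<Rightarrow> real"
    and I :: "real set"
    and x :: "real \<Rightarrow> 'n \<Rightarrow> real^2"
    and U dU :: "real \<Rightarrow> 'c \<Rightarrow> cell_state"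
    and Z :: "'n \<Rightarrow> real"
  assumes scheme: "htc_scheme M E1 cs ch \<theta>\<^sub>1 \<tau>\<^sub>1 0 eps m I x U dU"
    and init: "\<And>c. c \<in> cells M \<Longrightarrow> impulse (U 0 c) = disc_grad M (x 0) Z c"
  shows "\<forall>t\<in>I. \<forall>p. interior_node M p \<longrightarrow> dual_curl M (x t) (\<lambda>c. impulse (U t c)) p = 0"
proof (intro ballI allI impI)
  fix t p
  assume t: "t \<in> I" and p: "interior_node M p"
  interpret htc_scheme M E1 cs ch \<theta>\<^sub>1 \<tau>\<^sub>1 0 eps m I x U dU "energy E1 cs ch"
    by (fact scheme)
  show "dual_curl M (x t) (\<lambda>c. impulse (U t c)) p = 0"
  proof (rule dual_curl_eq_0[OF mesh[OF t] p])
    fix c assume "c \<in> cells_at M p"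
    then show "impulse (U t c) $ 3 = 0"
      using impulse_third_eq_0[OF refl _ _ t] init by (auto simp: cells_at_def)
  next
    fix c c' q
    assume "c \<in> cells_at M p" "c' \<in> cells_at M p" "q \<in> verts M c" "q \<in> verts M c'"
    then show "planar (impulse (U t c)) \<bullet> (x t q - x t p) = planar (impulse (U t c')) \<bullet> (x t q - x t p)"
      using tangential_impulse_continuous_across_edge[OF refl init _ _ _ _ _ _ t]
      by (auto simp: cells_at_def)
  qed
qed

end
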